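(* Let $\Phi=\{\varphi_j\}_{j=1}^M\subset\mathbb{R}^N\setminus\{0\}$ be a frame for $\mathbb{R}^N$. Then the following statements are equivalent. (i) $\Phi$ is not scalable. (ii) There exists a symmetric matrix $Y\in\mathbb{R}^{N\times N}$ with $\operatorname{tr}(Y)<0$ such that $\varphi_j^TY\varphi_j\ge 0$ for all $j=1,\ldots,M$. (iii) There exists a symmetric matrix $Y\in\mathbb{R}^{N\times N}$ with $\operatorname{tr}(Y)=0$ such that $\varphi_j^TY\varphi_j>0$ for all $j=1,\ldots,M$.
   Context: A finite family $\{\varphi_j\}_{j=1}^M\subset\mathbb{R}^N$ is a frame for $\mathbb{R}^N$ if there are $A,B>0$ with $A\|x\|^2\le\sum_{j=1}^M|\langle x,\varphi_j\rangle|^2\le B\|x\|^2$ for all $x\in\mathbb{R}^N$; it is a Parseval frame if this holds with $A=B=1$. A frame $\{\varphi_j\}_{j=1}^M$ is scalable if there exist scalars $c_j\ge 0$, $j=1,\ldots,M$, such that $\{c_j\varphi_j\}_{j=1}^M$ is a Parseval frame. *)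

theory Defs
  imports "HOL-Analysis.Analysis"
begin

(* A family (phi_1, ..., phi_M) is given by the values of phi on {1..M};
   the values elsewhere are irrelevant. *)

definition frame_with_bounds ::
    "real \<Rightarrow> real \<Rightarrow> nat \<Rightarrow> (nat \<Rightarrow> real ^ 'n) \<Rightarrow> bool" where
  "frame_with_bounds A B M \<phi> \<longleftrightarrow>
     (\<forall>x. A * (norm x)\<^sup>2 \<le> (\<Sum>j=1..M. \<bar>x \<bullet> \<phi> j\<bar>\<^sup>2) \<and>
          (\<Sum>j=1..M. \<bar>x \<bullet> \<phi> j\<bar>\<^sup>2) \<le> B * (norm x)\<^sup>2)"

definition is_frame :: "nat \<Rightarrow> (nat \<Rightarrow> real ^ 'n) \<Rightarrow> bool" where
  "is_frame M \<phi> \<longleftrightarrow> (\<exists>A>0. \<exists>B>0. frame_with_bounds A B M \<phi>)"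

definition is_parseval_frame :: "nat \<Rightarrow> (nat \<Rightarrow> real ^ 'n) \<Rightarrow> bool" where
  "is_parseval_frame M \<phi> \<longleftrightarrow> frame_with_bounds 1 1 M \<phi>"

definition scalable :: "nat \<Rightarrow> (nat \<Rightarrow> real ^ 'n) \<Rightarrow> bool" where
  "scalable M \<phi> \<longleftrightarrow>
     (\<exists>c :: nat \<Rightarrow> real. (\<forall>j\<in>{1..M}. 0 \<le> c j) \<and>
        is_parseval_frame M (\<lambda>j. c j *\<^sub>R \<phi> j))"

definition symmetric_matrix :: "real ^ 'n ^ 'n \<Rightarrow> bool" where
  "symmetric_matrix Y \<longleftrightarrow> transpose Y = Y"

end

theory Submission
  imports Defs
begin

text \<open>With respect to the entrywise inner product on matrices, \<open>x\<^sup>T Y x\<close> is the inner product of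
  \<open>Y\<close> and \<open>x x\<^sup>T\<close>, the trace of \<open>Y\<close> is its inner product with the identity \<open>I\<close>, and a family is a
  Parseval frame iff its outer products add up to \<open>I\<close>. Hence scalability says that \<open>0\<close> lies in the
  convex hull of the trace-free matrices \<open>\<phi>\<^sub>j \<phi>\<^sub>j\<^sup>T / \<parallel>\<phi>\<^sub>j\<parallel>\<^sup>2 - I / N\<close>. This polytope is compact, so if
  it misses \<open>0\<close>, a strictly separating hyperplane, projected to the symmetric trace-free matrices,
  is the matrix sought in (iii). Statements (ii) and (iii) differ by a multiple of \<open>I\<close>.\<close>

definition outer :: "real ^ 'n \<Rightarrow> real ^ 'n ^ 'n" where
  "outer x = (\<chi> i k. x $ i * x $ k)"

lemma outer_scaleR: "outer (c *\<^sub>R x) = c\<^sup>2 *\<^sub>R outer x"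
  by (simp add: outer_def vec_eq_iff power2_eq_square)

lemma inner_outer: "Y \<bullet> outer x = x \<bullet> (Y *v x)"
  by (simp add: outer_def inner_vec_def matrix_vector_mult_def sum_distrib_left mult_ac)

lemma inner_transpose_outer: "transpose Y \<bullet> outer x = Y \<bullet> outer x"
  unfolding inner_vec_def outer_def transpose_def
  by (subst sum.swap) (simp add: mult.commute)

lemma inner_outer_outer: "outer x \<bullet> outer y = (x \<bullet> y)\<^sup>2"
  by (simp add: outer_def inner_vec_def power2_eq_square sum_product mult_ac)

lemma inner_mat_1: "Y \<bullet> mat 1 = trace Y"
  by (simp add: inner_vec_def mat_def trace_def if_distrib cong: if_cong)

lemma inner_mat_1_outer: "mat 1 \<bullet> outer x = (norm x)\<^sup>2"
  by (simp add: inner_outer power2_norm_eq_inner)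

lemma trace_transpose: "trace (transpose Y) = trace Y"
  by (simp add: trace_def transpose_def)

lemma trace_scaleR: "trace (c *\<^sub>R (Y :: real ^ 'n ^ 'n)) = c * trace Y"
  by (simp add: trace_def sum_distrib_left)

lemma is_parseval_frame_iff:
  "is_parseval_frame M \<psi> \<longleftrightarrow> (\<forall>x. (\<Sum>j=1..M. (x \<bullet> \<psi> j)\<^sup>2) = (norm x)\<^sup>2)"
  unfolding is_parseval_frame_def frame_with_bounds_def by (auto intro: order.antisym)

text \<open>Forward, polarization turns the identity for squares into one for the bilinear form, and
  axis vectors read off the matrix entries. Backward, pairing with \<open>outer x\<close> recovers
  the sum of squares.\<close>

lemma is_parseval_frame_iff_sum_outer:
  "is_parseval_frame M \<psi> \<longleftrightarrow> (\<Sum>j=1..M. outer (\<psi> j)) = mat 1"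
proof
  assume "is_parseval_frame M \<psi>"
  then have sq: "(\<Sum>j=1..M. (x \<bullet> \<psi> j)\<^sup>2) = x \<bullet> x" for x
    by (simp add: is_parseval_frame_iff power2_norm_eq_inner)
  have polarized: "(\<Sum>j=1..M. (x \<bullet> \<psi> j) * (y \<bullet> \<psi> j)) = x \<bullet> y" for x y
  proof -
    have "(\<Sum>j=1..M. ((x + y) \<bullet> \<psi> j)\<^sup>2) = (\<Sum>j=1..M. (x \<bullet> \<psi> j)\<^sup>2) + (\<Sum>j=1..M. (y \<bullet> \<psi> j)\<^sup>2)
        + 2 * (\<Sum>j=1..M. (x \<bullet> \<psi> j) * (y \<bullet> \<psi> j))"
      by (simp add: inner_add_left power2_sum sum.distrib sum_distrib_left mult.assoc)
    then show ?thesis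
      unfolding sq by (simp add: inner_add_left inner_add_right inner_commute)
  qed
  show "(\<Sum>j=1..M. outer (\<psi> j)) = mat 1"
  proof -
    have "(\<Sum>j=1..M. \<psi> j $ i * \<psi> j $ k) = (if i = k then 1 else 0)" for i k
      using polarized[of "axis i 1" "axis k 1"] by (simp add: inner_axis') (simp add: axis_def)
    then show ?thesis
      by (simp add: vec_eq_iff outer_def mat_def)
  qed
next
  assume "(\<Sum>j=1..M. outer (\<psi> j)) = mat 1"
  moreover have "(\<Sum>j=1..M. (x \<bullet> \<psi> j)\<^sup>2) = outer x \<bullet> (\<Sum>j=1..M. outer (\<psi> j))" for x
    by (simp add: inner_sum_right inner_outer_outer)
  ultimately show "is_parseval_frame M \<psi>"
    by (simp add: is_parseval_frame_iff inner_mat_1_outer inner_commute[of "outer _" "mat 1"])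
qed

text \<open>Substituting \<open>w j\<close> for the square of \<open>c j\<close> makes scalability
  linear: the identity lies in the cone spanned by the outer products.\<close>

lemma scalable_iff_sum_outer:
  "scalable M \<phi> \<longleftrightarrow>
     (\<exists>w :: nat \<Rightarrow> real. (\<forall>j\<in>{1..M}. 0 \<le> w j) \<and> (\<Sum>j=1..M. w j *\<^sub>R outer (\<phi> j)) = mat 1)"
proof
  assume "scalable M \<phi>"
  then obtain c :: "nat \<Rightarrow> real" where "(\<Sum>j=1..M. (c j)\<^sup>2 *\<^sub>R outer (\<phi> j)) = mat 1"
    by (auto simp: scalable_def is_parseval_frame_iff_sum_outer outer_scaleR)
  then show "\<exists>w :: nat \<Rightarrow> real. (\<forall>j\<in>{1..M}. 0 \<le> w j) \<and> (\<Sum>j=1..M. w j *\<^sub>R outer (\<phi> j)) = mat 1"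
    by (intro exI[of _ "\<lambda>j. (c j)\<^sup>2"]) simp
next
  assume "\<exists>w :: nat \<Rightarrow> real. (\<forall>j\<in>{1..M}. 0 \<le> w j) \<and> (\<Sum>j=1..M. w j *\<^sub>R outer (\<phi> j)) = mat 1"
  then obtain w :: "nat \<Rightarrow> real"
    where w: "\<forall>j\<in>{1..M}. 0 \<le> w j" "(\<Sum>j=1..M. w j *\<^sub>R outer (\<phi> j)) = mat 1"
    by blast
  have "(\<Sum>j=1..M. outer (sqrt (w j) *\<^sub>R \<phi> j)) = (\<Sum>j=1..M. w j *\<^sub>R outer (\<phi> j))"
    using w(1) by (intro sum.cong) (auto simp: outer_scaleR)
  then show "scalable M \<phi>"
    using w by (auto simp: scalable_def is_parseval_frame_iff_sum_outer
        intro!: exI[of _ "\<lambda>j. sqrt (w j)"])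
qed

lemma convex_hull_image_finite_weights:
  fixes f :: "'i \<Rightarrow> 'a :: real_vector"
  assumes "finite I" "y \<in> convex hull (f ` I)"
  obtains u where "\<And>i. 0 \<le> u i" "sum u I = 1" "(\<Sum>i\<in>I. u i *\<^sub>R f i) = y"
proof -
  \<comment> \<open>\<open>J\<close> keeps one index per point; all other indices will get weight
    0.\<close>
  obtain J where J: "J \<subseteq> I" "inj_on f J" "f ` I = f ` J"
    using subset_image_inj[of "f ` I" f I] by auto
  obtain v where v: "\<forall>x\<in>f ` J. 0 \<le> v x" "sum v (f ` J) = 1" "(\<Sum>x\<in>f ` J. v x *\<^sub>R x) = y"
    using assms J by (auto simp: convex_hull_finite[of "f ` J"] finite_subset)
  define u where "u i = (if i \<in> J then v (f i) else 0)" for i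
  have "sum u I = (\<Sum>i\<in>J. v (f i))"
    using assms(1) J(1) by (intro sum.mono_neutral_cong_right) (auto simp: u_def)
  moreover have "(\<Sum>i\<in>I. u i *\<^sub>R f i) = (\<Sum>i\<in>J. v (f i) *\<^sub>R f i)"
    using assms(1) J(1) by (intro sum.mono_neutral_cong_right) (auto simp: u_def)
  ultimately show thesis
    using v J(2) by (intro that[of u]) (auto simp: u_def sum.reindex)
qed

text \<open>This is the orthogonal projection of \<open>Y\<close>. Its antisymmetric part is
  orthogonal to every \<open>outer x\<close>, so only the removed multiple of the identity changes
  the quadratic form.\<close>

lemma symmetric_trace_zero_part:
  fixes Y :: "real ^ 'n ^ 'n"
  obtains Z where "symmetric_matrix Z" "trace Z = 0"
    "\<And>x. x \<bullet> (Z *v x) = Y \<bullet> outer x - trace Y / CARD('n) * (norm x)\<^sup>2"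
proof
  define Z where "Z = (1/2) *\<^sub>R (Y + transpose Y) - (trace Y / CARD('n)) *\<^sub>R mat 1"
  show "symmetric_matrix Z"
    by (auto simp: symmetric_matrix_def Z_def vec_eq_iff transpose_def mat_def)
  show "trace Z = 0"
    by (simp add: Z_def trace_sub trace_add trace_scaleR trace_transpose trace_I)
  show "x \<bullet> (Z *v x) = Y \<bullet> outer x - trace Y / CARD('n) * (norm x)\<^sup>2" for x
    by (simp add: Z_def inner_diff_left inner_add_left inner_transpose_outer inner_mat_1_outer
        flip: inner_outer)
qed

text \<open>Pairing \<open>Y\<close> with the decomposition of the identity into weighted outer
  products writes the trace as a sum of nonnegative terms. This refutes scalability under
  (ii).\<close>

lemma scalable_imp_trace_nonneg:
  fixes Y :: "real ^ 'n ^ 'n"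
  assumes "scalable M \<phi>" "\<forall>j\<in>{1..M}. 0 \<le> \<phi> j \<bullet> (Y *v \<phi> j)"
  shows "0 \<le> trace Y"
proof -
  obtain w :: "nat \<Rightarrow> real"
    where w: "\<forall>j\<in>{1..M}. 0 \<le> w j" "(\<Sum>j=1..M. w j *\<^sub>R outer (\<phi> j)) = mat 1"
    using assms(1) by (auto simp: scalable_iff_sum_outer)
  have "trace Y = (\<Sum>j=1..M. w j * (Y \<bullet> outer (\<phi> j)))"
    by (simp add: inner_sum_right flip: inner_mat_1 w(2))
  also have "\<dots> \<ge> 0"
    using w(1) assms(2) by (intro sum_nonneg) (simp add: inner_outer)
  finally show ?thesis .
qed

lemma not_scalable_imp_trace_zero:
  fixes \<phi> :: "nat \<Rightarrow> real ^ 'n"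
  assumes nonzero: "\<forall>j\<in>{1..M}. \<phi> j \<noteq> 0" and "\<not> scalable M \<phi>"
  shows "\<exists>Y :: real ^ 'n ^ 'n. symmetric_matrix Y \<and> trace Y = 0 \<and>
    (\<forall>j\<in>{1..M}. \<phi> j \<bullet> (Y *v \<phi> j) > 0)"
proof -
  define N where "N = real CARD('n)"
  have "N > 0"
    by (simp add: N_def)
  \<comment> \<open>Every normalized outer product has trace 1, hence \<open>f j\<close> has trace
    0. A convex combination of these that vanishes writes \<open>(1 / N) *\<^sub>R mat 1\<close> as
    a nonnegative combination of outer products.\<close>
  define f where "f j = (1 / (norm (\<phi> j))\<^sup>2) *\<^sub>R outer (\<phi> j) - (1 / N) *\<^sub>R mat 1" for j
  have "0 \<notin> convex hull (f ` {1..M})"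
  proof
    assume "0 \<in> convex hull (f ` {1..M})"
    then obtain u :: "nat \<Rightarrow> real"
      where u: "\<And>j. 0 \<le> u j" "sum u {1..M} = 1" "(\<Sum>j=1..M. u j *\<^sub>R f j) = 0"
      by (rule convex_hull_image_finite_weights[OF finite_atLeastAtMost]) blast
    have "(\<Sum>j=1..M. u j *\<^sub>R f j) =
        (\<Sum>j=1..M. (u j / (norm (\<phi> j))\<^sup>2) *\<^sub>R outer (\<phi> j)) - (sum u {1..M} / N) *\<^sub>R mat 1"
      by (simp add: f_def scaleR_diff_right sum_subtractf scaleR_left.sum sum_divide_distrib)
    then have "(\<Sum>j=1..M. (u j / (norm (\<phi> j))\<^sup>2) *\<^sub>R outer (\<phi> j)) = (1 / N) *\<^sub>R mat 1"
      using u by simp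
    then have "N *\<^sub>R (\<Sum>j=1..M. (u j / (norm (\<phi> j))\<^sup>2) *\<^sub>R outer (\<phi> j)) = mat 1"
      using \<open>N > 0\<close> by simp
    then have "(\<Sum>j=1..M. (N * u j / (norm (\<phi> j))\<^sup>2) *\<^sub>R outer (\<phi> j)) = mat 1"
      by (simp add: scaleR_sum_right)
    then have "scalable M \<phi>"
      unfolding scalable_iff_sum_outer using u(1) \<open>N > 0\<close>
      by (intro exI[of _ "\<lambda>j. N * u j / (norm (\<phi> j))\<^sup>2"]) simp
    with assms show False by simp
  qed
  then obtain Y b where "b > 0" and sep: "\<forall>X\<in>convex hull (f ` {1..M}). Y \<bullet> X > b"
    using separating_hyperplane_closed_0[of "convex hull (f ` {1..M})"]
    by (auto simp: compact_imp_closed finite_imp_compact_convex_hull)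
  obtain Z where Z: "symmetric_matrix Z" "trace Z = 0"
    "\<And>x. x \<bullet> (Z *v x) = Y \<bullet> outer x - trace Y / CARD('n) * (norm x)\<^sup>2"
    using symmetric_trace_zero_part[of Y] by blast
  have "\<phi> j \<bullet> (Z *v \<phi> j) > 0" if j: "j \<in> {1..M}" for j
  proof -
    have "f j \<in> convex hull (f ` {1..M})"
      using j by (simp add: hull_inc)
    with sep \<open>b > 0\<close> have "Y \<bullet> f j > 0" by force
    \<comment> \<open>The identity term of \<open>f j\<close> matches the trace correction in
      \<open>Z\<close>, so positivity survives the projection.\<close>
    moreover have "\<phi> j \<bullet> (Z *v \<phi> j) = (norm (\<phi> j))\<^sup>2 * (Y \<bullet> f j)"
      using j nonzero
      by (auto simp: Z(3) f_def inner_diff_right inner_mat_1 N_def right_diff_distrib)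
    ultimately show ?thesis
      using j nonzero by simp
  qed
  with Z show ?thesis by blast
qed

text \<open>Strict positivity at finitely many vectors leaves room to subtract a small positive
  multiple of the identity, which makes the trace negative.\<close>

lemma trace_zero_imp_trace_neg:
  fixes \<phi> :: "nat \<Rightarrow> real ^ 'n" and Y :: "real ^ 'n ^ 'n"
  assumes "symmetric_matrix Y" "trace Y = 0" and pos: "\<forall>j\<in>{1..M}. \<phi> j \<bullet> (Y *v \<phi> j) > 0"
  shows "\<exists>Z :: real ^ 'n ^ 'n. symmetric_matrix Z \<and> trace Z < 0 \<and>
    (\<forall>j\<in>{1..M}. \<phi> j \<bullet> (Z *v \<phi> j) \<ge> 0)"
proof -
  define q where "q j = \<phi> j \<bullet> (Y *v \<phi> j) / (norm (\<phi> j))\<^sup>2" for j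
  have nz: "\<phi> j \<noteq> 0" if "j \<in> {1..M}" for j
    using pos that by force
  \<comment> \<open>A positive lower bound for the Rayleigh quotients \<open>q j\<close>; the
    inserted 1 keeps the set nonempty when \<open>M = 0\<close>.\<close>
  define e where "e = Min (insert 1 (q ` {1..M}))"
  have "e > 0"
    using pos nz by (simp add: e_def q_def)
  have e_le: "e * (norm (\<phi> j))\<^sup>2 \<le> \<phi> j \<bullet> (Y *v \<phi> j)" if j: "j \<in> {1..M}" for j
  proof -
    have "e \<le> q j"
      unfolding e_def using j by (intro Min_le) auto
    then show ?thesis
      using nz[OF j] by (simp add: q_def pos_le_divide_eq)
  qed
  define Z where "Z = Y - e *\<^sub>R mat 1"
  have "symmetric_matrix Z"
    using assms(1) by (auto simp: symmetric_matrix_def Z_def vec_eq_iff transpose_def mat_def)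
  moreover have "trace Z < 0"
    using assms(2) \<open>e > 0\<close> by (simp add: Z_def trace_sub trace_scaleR trace_I)
  moreover have "\<forall>j\<in>{1..M}. \<phi> j \<bullet> (Z *v \<phi> j) \<ge> 0"
    using e_le by (simp add: Z_def inner_diff_left inner_mat_1_outer flip: inner_outer)
  ultimately show ?thesis by blast
qed

theorem theorem3p2:
  fixes \<phi> :: "nat \<Rightarrow> real ^ 'n" and M :: nat
  assumes frame: "is_frame M \<phi>"
    and nonzero: "\<forall>j\<in>{1..M}. \<phi> j \<noteq> 0"
  shows "(\<not> scalable M \<phi> \<longleftrightarrow>
            (\<exists>Y :: real ^ 'n ^ 'n. symmetric_matrix Y \<and> trace Y < 0 \<and>
               (\<forall>j\<in>{1..M}. \<phi> j \<bullet> (Y *v \<phi> j) \<ge> 0)))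
       \<and> ((\<exists>Y :: real ^ 'n ^ 'n. symmetric_matrix Y \<and> trace Y < 0 \<and>
               (\<forall>j\<in>{1..M}. \<phi> j \<bullet> (Y *v \<phi> j) \<ge> 0)) \<longleftrightarrow>
            (\<exists>Y :: real ^ 'n ^ 'n. symmetric_matrix Y \<and> trace Y = 0 \<and>
               (\<forall>j\<in>{1..M}. \<phi> j \<bullet> (Y *v \<phi> j) > 0)))"
    (is "(?i \<longleftrightarrow> ?ii) \<and> (_ \<longleftrightarrow> ?iii)")
proof -
  \<comment> \<open>The equivalences follow from the cycle (ii), (i), (iii), (ii).\<close>
  have "?ii \<Longrightarrow> ?i"
    using scalable_imp_trace_nonneg by (meson not_le)
  moreover have "?i \<Longrightarrow> ?iii"
    using not_scalable_imp_trace_zero[OF nonzero] by blast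
  moreover have "?iii \<Longrightarrow> ?ii"
    using trace_zero_imp_trace_neg by blast
  ultimately show ?thesis by blast
qed

end
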